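(* Let $\alpha,\beta>0$ with $\frac{\alpha}{\beta}=\frac{n}{m}$, where $n,m$ are positive coprime integers. Let $\lambda,\sigma\in\mathbb{C}$ with $\lambda^m\neq\sigma^n$. (i) Let $w_1,w_2>-1$ and $w=w_1+w_2$. Then for all $t>0$, $$P_{\alpha,w_1}(\lambda,t)*P_{\beta,w_2}(\sigma,t)=\sum_{j=0}^{n-1}\frac{\sigma^j\lambda^m}{\lambda^m-\sigma^n}\,P_{\alpha,w+1+\beta j}(\lambda,t)+\sum_{k=0}^{m-1}\frac{\lambda^k\sigma^n}{\sigma^n-\lambda^m}\,P_{\beta,w+1+\alpha k}(\sigma,t).$$ (ii) Equivalently, in terms of Mittag-Leffler functions, for $w_1,w_2>-1$, $w=w_1+w_2$ and all $t>0$, $$t^{w_1}E_{\alpha,w_1+1}(\lambda t^\alpha)*t^{w_2}E_{\beta,w_2+1}(\sigma t^\beta)=\sum_{j=0}^{n-1}\frac{\sigma^j\lambda^m t^{w+1+\beta j}}{\lambda^m-\sigma^n}E_{\alpha,w+2+\beta j}(\lambda t^\alpha)+\sum_{k=0}^{m-1}\frac{\lambda^k\sigma^n t^{w+1+\alpha k}}{\sigma^n-\lambda^m}E_{\beta,w+2+\alpha k}(\sigma t^\beta).$$ (iii) Let $v_1<\alpha$, $v_2<\beta$ and $v=v_1+v_2$. Then for all $t>0$, $$R_{\alpha,v_1}(\lambda,t)*R_{\beta,v_2}(\sigma,t)=\sum_{j=0}^{n-1}\frac{\sigma^j\lambda^m}{\lambda^m-\sigma^n}R_{\alpha,v-\b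eta(j+1)}(\lambda,t)+\sum_{k=0}^{m-1}\frac{\lambda^k\sigma^n}{\sigma^n-\lambda^m}R_{\beta,v-\alpha(k+1)}(\sigma,t).$$
   Context: For $\alpha,\beta>0$ and $z\in\mathbb{C}$, the Mittag-Leffler function is $E_{\alpha,\beta}(z)=\sum_{n=0}^\infty \frac{z^n}{\Gamma(\alpha n+\beta)}$. For $\lambda\in\mathbb{C}$, $\alpha>0$, $t>0$: $P_{\alpha,w}(\lambda,t)=t^wE_{\alpha,w+1}(\lambda t^\alpha)=\sum_{n=0}^\infty\frac{\lambda^n t^{\alpha n+w}}{\Gamma(\alpha n+w+1)}$ for $w>-1$, and $R_{\alpha,v}(\lambda,t)=t^{\alpha-v-1}E_{\alpha,\alpha-v}(\lambda t^\alpha)=\sum_{n=0}^\infty\frac{\lambda^n t^{\alpha(n+1)-v-1}}{\Gamma(\alpha(n+1)-v)}$ for $v<\alpha$. The symbol $*$ denotes the causal convolution in the variable $t$: $(f*g)(t)=\int_0^t f(t-\tau)g(\tau)\,d\tau$. Convention: $0^0=1$. *)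

theory Defs
  imports "HOL-Analysis.Analysis" "HOL-Real_Asymp.Real_Asymp"
begin

definition mittag_leffler :: "real \<Rightarrow> real \<Rightarrow> complex \<Rightarrow> complex" where
  "mittag_leffler \<alpha> \<beta> z = (\<Sum>k. z ^ k / of_real (Gamma (\<alpha> * real k + \<beta>)))"

lemma summable_mittag_leffler:
  fixes \<alpha> b :: real and z :: complex
  assumes "\<alpha> > 0"
  shows "summable (\<lambda>k. z ^ k / of_real (Gamma (\<alpha> * real k + b)))"
proof -
  define A where "A = 2 * norm z + 1"
  define R where "R = A powr (1 / \<alpha>)"
  have A: "A \<ge> 1" by (simp add: A_def)
  have zA: "norm z / A \<le> 1 / 2" using A A_def by (subst pos_divide_le_eq) linarith+
  have R1: "R \<ge> 1" using A assms by (simp add: R_def ge_one_powr_ge_zero)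
  have RA: "R powr \<alpha> = A" using A assms by (simp add: R_def powr_powr)
  have Gamma_bound: "1 / Gamma x \<le> exp R * R powr (2 - x)" if x: "x \<ge> 3" for x :: real
  proof -
    define N where "N = nat \<lfloor>x\<rfloor> - 1"
    have N: "real N \<le> x - 1" "real N \<ge> x - 2" "N \<ge> 2" using x unfolding N_def by linarith+
    have "fact N = Gamma (1 + real N)" by (simp add: Gamma_fact)
    also have "\<dots> \<le> Gamma x"
    proof (cases "1 + real N = x")
      case False
      then show ?thesis using N x by (intro less_imp_le Gamma_real_strict_mono) auto
    qed simp
    finally have 1: "fact N \<le> Gamma x" .
    have "(\<Sum>i\<in>{N}. inverse (fact i) * R ^ i) \<le> (\<Sum>i. inverse (fact i) * R ^ i)"
      using R1 by (intro sum_le_suminf summable_exp) auto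
    then have 2: "R ^ N / fact N \<le> exp R"
      by (simp add: exp_def divide_inverse mult.commute)
    have "R powr (x - 2) \<le> R ^ N"
      using R1 N by (simp add: powr_mono flip: powr_realpow)
    then have "R powr (x - 2) / fact N \<le> exp R"
      using 2 by (meson divide_right_mono fact_ge_zero order_trans)
    then have "1 / fact N \<le> exp R / R powr (x - 2)"
      using R1 by (simp add: field_simps)
    moreover have "1 / Gamma x \<le> 1 / fact N"
      using 1 by (simp add: frac_le)
    moreover have "exp R / R powr (x - 2) = exp R * R powr (2 - x)"
      using R1 by (simp add: powr_diff field_simps)
    ultimately show ?thesis by linarith
  qed
  show ?thesis
  proof (rule summable_comparison_test_ev)
    have "\<forall>\<^sub>F k in sequentially. \<alpha> * real k + b \<ge> 3"
      using assms by real_asymp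
    then show "\<forall>\<^sub>F k in sequentially. norm (z ^ k / of_real (Gamma (\<alpha> * real k + b)))
        \<le> exp R * R powr (2 - b) * (1 / 2) ^ k"
    proof eventually_elim
      case (elim k)
      have "norm (z ^ k / of_real (Gamma (\<alpha> * real k + b))) =
          norm z ^ k * (1 / Gamma (\<alpha> * real k + b))"
        using elim by (simp add: norm_divide norm_power)
      also have "\<dots> \<le> norm z ^ k * (exp R * R powr (2 - (\<alpha> * real k + b)))"
        by (intro mult_left_mono Gamma_bound elim) auto
      also have "R powr (2 - (\<alpha> * real k + b)) = R powr (2 - b) / (R powr \<alpha>) powr real k"
        by (simp add: powr_powr algebra_simps flip: powr_diff)
      also have "\<dots> = R powr (2 - b) / A ^ k"
        using A by (simp add: RA powr_realpow)
      also have "norm z ^ k * (exp R * (R powr (2 - b) / A ^ k)) =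
          exp R * R powr (2 - b) * (norm z / A) ^ k"
        by (simp add: power_divide)
      also have "\<dots> \<le> exp R * R powr (2 - b) * (1 / 2) ^ k"
        using A zA by (intro mult_left_mono power_mono) auto
      finally show ?case .
    qed
    show "summable (\<lambda>k. exp R * R powr (2 - b) * (1 / 2) ^ k)"
      by (intro summable_mult summable_geometric) auto
  qed
qed

definition P_fun :: "real \<Rightarrow> real \<Rightarrow> complex \<Rightarrow> real \<Rightarrow> complex" where
  "P_fun \<alpha> w lam t =
     of_real (t powr w) * mittag_leffler \<alpha> (w + 1) (lam * of_real (t powr \<alpha>))"

definition R_fun :: "real \<Rightarrow> real \<Rightarrow> complex \<Rightarrow> real \<Rightarrow> complex" where
  "R_fun \<alpha> v lam t =
     of_real (t powr (\<alpha> - v - 1)) * mittag_leffler \<alpha> (\<alpha> - v) (lam * of_real (t powr \<alpha>))"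

lemma powr_mult_mittag_leffler:
  assumes "\<alpha> > 0" "t > 0"
  shows "of_real (t powr a) * mittag_leffler \<alpha> b (lam * of_real (t powr \<alpha>)) =
    (\<Sum>k. lam ^ k * of_real (t powr (\<alpha> * real k + a)) / of_real (Gamma (\<alpha> * real k + b)))"
proof -
  define c where "c = complex_of_real (t powr a)"
  define f where "f k = (lam * of_real (t powr \<alpha>)) ^ k / of_real (Gamma (\<alpha> * real k + b))" for k
  have "c * suminf f = (\<Sum>k. c * f k)"
    unfolding f_def by (intro suminf_mult[symmetric] summable_mittag_leffler assms)
  moreover have "c * f k =
      lam ^ k * of_real (t powr (\<alpha> * real k + a)) / of_real (Gamma (\<alpha> * real k + b))" for k
    using assms
    by (simp add: c_def f_def powr_add power_mult_distrib powr_powr[symmetric] powr_realpow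
        flip: of_real_power)
  ultimately have "c * suminf f =
      (\<Sum>k. lam ^ k * of_real (t powr (\<alpha> * real k + a)) / of_real (Gamma (\<alpha> * real k + b)))"
    by (simp only:)
  then show ?thesis unfolding c_def f_def mittag_leffler_def .
qed

lemma P_fun_series:
  assumes "\<alpha> > 0" "t > 0"
  shows "P_fun \<alpha> w lam t =
    (\<Sum>k. lam ^ k * of_real (t powr (\<alpha> * real k + w)) / of_real (Gamma (\<alpha> * real k + w + 1)))"
  using powr_mult_mittag_leffler[OF assms, of w "w + 1" lam]
  by (simp add: P_fun_def add.assoc)

lemma R_fun_series:
  assumes "\<alpha> > 0" "t > 0"
  shows "R_fun \<alpha> v lam t =
    (\<Sum>k. lam ^ k * of_real (t powr (\<alpha> * (real k + 1) - v - 1)) /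
          of_real (Gamma (\<alpha> * (real k + 1) - v)))"
  using powr_mult_mittag_leffler[OF assms, of "\<alpha> - v - 1" "\<alpha> - v" lam]
  by (simp add: R_fun_def algebra_simps)

definition causal_conv :: "(real \<Rightarrow> complex) \<Rightarrow> (real \<Rightarrow> complex) \<Rightarrow> real \<Rightarrow> complex" where
  "causal_conv f g t = (LBINT \<tau>:{0..t}. f (t - \<tau>) * g \<tau>)"

text \<open>The Bochner integral of a non-integrable function is 0 in the library, so equations between
  \<open>causal_conv f g t\<close> and explicit values are accompanied by absolute convergence of the integral.\<close>

definition causal_conv_exists :: "(real \<Rightarrow> complex) \<Rightarrow> (real \<Rightarrow> complex) \<Rightarrow> real \<Rightarrow> bool" where
  "causal_conv_exists f g t \<longleftrightarrow> set_integrable lborel {0..t} (\<lambda>\<tau>. f (t - \<tau>) * g \<tau>)"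

end

theory Submission
  imports Defs
begin

text \<open>By the Beta integral, expanding both factors into power series and integrating termwise turns the
  convolution into \<open>S = (\<Sum>k l. lam ^ k * \<sigma> ^ l * g (\<alpha> * k + \<beta> * l))\<close> with
  \<open>g u = t powr (u + w + 1) / Gamma (u + w + 2)\<close>. Since \<open>\<alpha> * m = \<beta> * n\<close>, the part of
  \<open>lam ^ m * S\<close> with \<open>l \<ge> n\<close> equals the part of \<open>\<sigma> ^ n * S\<close> with \<open>k \<ge> m\<close>. These cancel in
  \<open>(lam ^ m - \<sigma> ^ n) * S\<close>, and the remaining strips \<open>l < n\<close> and \<open>k < m\<close> are finite sums of
  Mittag-Leffler series. The claim about \<open>R_fun\<close> is the one about \<open>P_fun\<close> with
  \<open>w1 = \<alpha> - v1 - 1\<close> and \<open>w2 = \<beta> - v2 - 1\<close>.\<close>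

section \<open>Beta integral on an interval of length \<open>t\<close>\<close>

text \<open>Rescaling by \<open>1 / t\<close> carries Euler's Beta integral from the unit interval
  to \<open>{0..t}\<close> and produces the factor \<open>t powr (a + b + 1)\<close>. Exponents
  above -1 keep both endpoint singularities integrable.\<close>

lemma Beta_convolution:
  fixes a b t :: real
  assumes "a > -1" "b > -1" "t > 0"
  shows "set_integrable lborel {0..t} (\<lambda>x. (t - x) powr a * x powr b)"
    and "(LBINT x:{0..t}. (t - x) powr a * x powr b) =
      t powr (a + b + 1) * Gamma (a + 1) * Gamma (b + 1) / Gamma (a + b + 2)"
proof -
  have "((\<lambda>x. x powr b * (1 - x) powr a) has_integral Beta (b + 1) (a + 1)) (cbox 0 1)"
    using has_integral_Beta_real[of "b + 1" "a + 1"] assms by simp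
  from has_integral_affinity'[OF this, of "1 / t" 0] assms
  have "((\<lambda>x. (x / t) powr b * (1 - x / t) powr a) has_integral t * Beta (b + 1) (a + 1)) {0..t}"
    by simp
  from has_integral_mult_right[OF this, of "t powr (a + b)"]
  have "((\<lambda>x. t powr (a + b) * ((x / t) powr b * (1 - x / t) powr a)) has_integral
      t powr (a + b) * (t * Beta (b + 1) (a + 1))) {0..t}" .
  also have "?this \<longleftrightarrow> ((\<lambda>x. (t - x) powr a * x powr b) has_integral
      t powr (a + b) * (t * Beta (b + 1) (a + 1))) {0..t}"
  proof (rule has_integral_cong)
    fix x assume x: "x \<in> {0..t}"
    have "1 - x / t = (t - x) / t" using assms by (simp add: field_simps)
    then show "t powr (a + b) * ((x / t) powr b * (1 - x / t) powr a) = (t - x) powr a * x powr b"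
      using assms x by (simp add: powr_divide powr_add)
  qed
  finally have hk: "((\<lambda>x. (t - x) powr a * x powr b) has_integral
      t powr (a + b) * (t * Beta (b + 1) (a + 1))) {0..t}" .
  \<comment> \<open>For a nonnegative integrand, the gauge integral just computed already gives
    absolute integrability. Borel measurability then allows the passage from the completed measure
    to \<open>lborel\<close>.\<close>
  have "(\<lambda>x. (t - x) powr a * x powr b) absolutely_integrable_on {0..t}"
    using hk by (intro nonnegative_absolutely_integrable_1) auto
  then show int: "set_integrable lborel {0..t} (\<lambda>x. (t - x) powr a * x powr b)"
    unfolding set_integrable_def by (subst (asm) integrable_completion) measurable
  have "(LBINT x:{0..t}. (t - x) powr a * x powr b) = t powr (a + b) * (t * Beta (b + 1) (a + 1))"
    using set_borel_integral_eq_integral(2)[OF int] hk by (simp add: integral_unique)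
  also have "\<dots> = t powr (a + b + 1) * Gamma (a + 1) * Gamma (b + 1) / Gamma (a + b + 2)"
    using assms by (simp add: Beta_def powr_add algebra_simps)
  finally show "(LBINT x:{0..t}. (t - x) powr a * x powr b) =
      t powr (a + b + 1) * Gamma (a + 1) * Gamma (b + 1) / Gamma (a + b + 2)" .
qed

section \<open>Double series: cancellation and termwise integration\<close>

text \<open>Unconditional summability allows the same sum to be split in two ways, at
  \<open>k = m\<close> and at \<open>l = n\<close>. Both remainders are reindexed over the full
  quadrant, where \<open>shift\<close> matches them term by term.\<close>

lemma infsum_lattice_strips:
  fixes h :: "nat \<times> nat \<Rightarrow> complex"
  assumes sm: "h summable_on UNIV"
    and shift: "\<And>k l. a * h (k, l + n) = b * h (k + m, l)"
  shows "(a - b) * infsum h UNIV =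
    a * (\<Sum>l<n. \<Sum>\<^sub>\<infinity>k. h (k, l)) - b * (\<Sum>k<m. \<Sum>\<^sub>\<infinity>l. h (k, l))"
proof -
  have sub: "h summable_on A" for A
    using sm summable_on_subset_banach by blast
  have A: "infsum h UNIV = (\<Sum>k<m. \<Sum>\<^sub>\<infinity>l. h (k, l)) + (\<Sum>\<^sub>\<infinity>(k, l). h (k + m, l))"
  proof -
    have "infsum h UNIV = infsum h ({..<m} \<times> UNIV) + infsum h ({m..} \<times> UNIV)"
      by (subst infsum_Un_disjoint[symmetric]) (auto intro: sub intro!: arg_cong2[where f = infsum])
    also have "infsum h ({..<m} \<times> UNIV) = (\<Sum>k<m. \<Sum>\<^sub>\<infinity>l. h (k, l))"
      by (subst infsum_Sigma_banach[symmetric]) (auto intro: sub)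
    also have "infsum h ({m..} \<times> UNIV) = (\<Sum>\<^sub>\<infinity>(k, l). h (k + m, l))"
      by (rule infsum_reindex_bij_witness[of _ "\<lambda>(k, l). (k + m, l)" "\<lambda>(k, l). (k - m, l)"]) auto
    finally show ?thesis .
  qed
  have B: "infsum h UNIV = (\<Sum>l<n. \<Sum>\<^sub>\<infinity>k. h (k, l)) + (\<Sum>\<^sub>\<infinity>(k, l). h (k, l + n))"
  proof -
    have "infsum h UNIV = infsum h (UNIV \<times> {..<n}) + infsum h (UNIV \<times> {n..})"
      by (subst infsum_Un_disjoint[symmetric]) (auto intro: sub intro!: arg_cong2[where f = infsum])
    \<comment> \<open>The iterated sum takes the first coordinate as its outer index, so this strip
      is transposed first to make the finite index \<open>l\<close> the outer one.\<close>
    also have "infsum h (UNIV \<times> {..<n}) = infsum (\<lambda>(l, k). h (k, l)) ({..<n} \<times> UNIV)"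
      by (rule infsum_reindex_bij_witness[of _ prod.swap prod.swap]) auto
    also have "\<dots> = (\<Sum>l<n. \<Sum>\<^sub>\<infinity>k. h (k, l))"
    proof (subst infsum_Sigma_banach[symmetric])
      have "h summable_on (UNIV \<times> {..<n}) \<longleftrightarrow> (\<lambda>(l, k). h (k, l)) summable_on {..<n} \<times> UNIV"
        by (rule summable_on_reindex_bij_witness[of _ prod.swap prod.swap]) auto
      then show "(\<lambda>(l, k). h (k, l)) summable_on {..<n} \<times> UNIV"
        using sub by blast
    qed auto
    also have "infsum h (UNIV \<times> {n..}) = (\<Sum>\<^sub>\<infinity>(k, l). h (k, l + n))"
      by (rule infsum_reindex_bij_witness[of _ "\<lambda>(k, l). (k, l + n)" "\<lambda>(k, l). (k, l - n)"]) auto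
    finally show ?thesis .
  qed
  have "a * (\<Sum>\<^sub>\<infinity>(k, l). h (k, l + n)) = b * (\<Sum>\<^sub>\<infinity>(k, l). h (k + m, l))"
    unfolding infsum_cmult_right'[symmetric] by (rule infsum_cong) (use shift in auto)
  moreover have "(a - b) * infsum h UNIV = a * infsum h UNIV - b * infsum h UNIV"
    by (simp add: algebra_simps)
  \<comment> \<open>The copy of the sum with factor \<open>b\<close> is split by \<open>A\<close>,
    the one with factor \<open>a\<close> by \<open>B\<close>; the two remainders then
    cancel.\<close>
  ultimately show ?thesis
    by (subst (asm) (2) A, subst (asm) B) (simp add: algebra_simps)
qed

text \<open>A single integrable \<open>G\<close> above all finite sums of norms serves twice:
  pointwise it gives absolute summability, and after integration it bounds the sums of the integrals
  of the norms. Enumerating the pairs by \<open>prod_decode\<close> reduces the claim to integration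
  of an ordinary series.\<close>

lemma integral_dominated_infsum_pairs:
  fixes F :: "nat \<times> nat \<Rightarrow> 'a \<Rightarrow> 'b :: {banach, second_countable_topology}"
  assumes F: "\<And>p. integrable M (F p)"
    and G: "integrable M G"
    and bound: "\<And>X x. finite X \<Longrightarrow> x \<in> space M \<Longrightarrow> (\<Sum>p\<in>X. norm (F p x)) \<le> G x"
  shows "integrable M (\<lambda>x. \<Sum>\<^sub>\<infinity>p. F p x)"
    and "(\<lambda>p. integral\<^sup>L M (F p)) summable_on UNIV"
    and "(\<integral>x. (\<Sum>\<^sub>\<infinity>p. F p x) \<partial>M) = (\<Sum>\<^sub>\<infinity>p. integral\<^sup>L M (F p))"
proof -
  define f where "f i = F (prod_decode i)" for i
  have ptw: "(\<lambda>p. norm (F p x)) summable_on UNIV" if "x \<in> space M" for x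
    by (rule nonneg_bdd_above_summable_on) (use bound that in \<open>auto intro!: bdd_aboveI2\<close>)
  have smf: "summable (\<lambda>i. norm (f i x))" if "x \<in> space M" for x
    using ptw[OF that] summable_on_reindex_bij_betw[OF bij_prod_decode, of "\<lambda>p. norm (F p x)"]
    by (auto simp: f_def intro: summable_on_imp_summable)
  have eq: "(\<Sum>\<^sub>\<infinity>p. F p x) = (\<Sum>i. f i x)" if "x \<in> space M" for x
  proof -
    have "(\<Sum>\<^sub>\<infinity>p. F p x) = (\<Sum>\<^sub>\<infinity>i. f i x)"
      unfolding f_def by (rule infsum_reindex_bij_betw[OF bij_prod_decode, symmetric])
    also have "\<dots> = (\<Sum>i. f i x)"
      using norm_summable_imp_has_sum[OF smf[OF that] summable_sums[OF summable_norm_cancel[OF smf[OF that]]]]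
      by (rule infsumI)
    finally show ?thesis .
  qed
  have "(\<lambda>p. \<integral>x. norm (F p x) \<partial>M) summable_on UNIV"
  proof (rule nonneg_bdd_above_summable_on)
    show "bdd_above (sum (\<lambda>p. \<integral>x. norm (F p x) \<partial>M) ` {X. X \<subseteq> UNIV \<and> finite X})"
    proof (rule bdd_aboveI2)
      fix X :: "(nat \<times> nat) set" assume "X \<in> {X. X \<subseteq> UNIV \<and> finite X}"
      then have "(\<Sum>p\<in>X. \<integral>x. norm (F p x) \<partial>M) = (\<integral>x. (\<Sum>p\<in>X. norm (F p x)) \<partial>M)"
        using F by (subst Bochner_Integration.integral_sum) auto
      also have "\<dots> \<le> integral\<^sup>L M G"
        using \<open>X \<in> _\<close> F G bound by (intro integral_mono) auto
      finally show "(\<Sum>p\<in>X. \<integral>x. norm (F p x) \<partial>M) \<le> integral\<^sup>L M G" .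
    qed
  qed auto
  note sint = this
  then have smi: "summable (\<lambda>i. \<integral>x. norm (f i x) \<partial>M)"
    using summable_on_reindex_bij_betw[OF bij_prod_decode, of "\<lambda>p. \<integral>x. norm (F p x) \<partial>M"]
    by (auto simp: f_def intro: summable_on_imp_summable)
  have "(\<lambda>p. norm (integral\<^sup>L M (F p))) summable_on UNIV"
    using sint by (rule Infinite_Sum.abs_summable_on_comparison_test') auto
  then show s: "(\<lambda>p. integral\<^sup>L M (F p)) summable_on UNIV"
    by (rule abs_summable_summable)
  have fi: "integrable M (f i)" for i by (simp add: f_def F)
  have ae: "AE x in M. summable (\<lambda>i. norm (f i x))" using smf by auto
  show "integrable M (\<lambda>x. \<Sum>\<^sub>\<infinity>p. F p x)"
    using integrable_suminf[OF fi ae smi] by (subst Bochner_Integration.integrable_cong[OF refl eq])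
  have "(\<integral>x. (\<Sum>\<^sub>\<infinity>p. F p x) \<partial>M) = (\<integral>x. (\<Sum>i. f i x) \<partial>M)"
    by (rule Bochner_Integration.integral_cong[OF refl eq])
  moreover have "(\<lambda>i. integral\<^sup>L M (f i)) sums (\<Sum>\<^sub>\<infinity>p. integral\<^sup>L M (F p))"
    using has_sum_infsum[OF s]
      has_sum_reindex_bij_betw[OF bij_prod_decode, of "\<lambda>p. integral\<^sup>L M (F p)"]
    by (auto simp: f_def intro: has_sum_imp_sums)
  ultimately show "(\<integral>x. (\<Sum>\<^sub>\<infinity>p. F p x) \<partial>M) = (\<Sum>\<^sub>\<infinity>p. integral\<^sup>L M (F p))"
    using sums_unique2 sums_integral[OF fi ae smi] by metis
qed

section \<open>Terms of the series of \<open>P_fun\<close> and their bounds\<close>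

definition P_term :: "real \<Rightarrow> real \<Rightarrow> complex \<Rightarrow> nat \<Rightarrow> real \<Rightarrow> complex" where
  "P_term \<alpha> w z k t = z ^ k * of_real (t powr (\<alpha> * real k + w) / Gamma (\<alpha> * real k + w + 1))"

text \<open>Separates the factor \<open>t powr w\<close>, possibly singular at 0, from the terms of
  a power series in \<open>t powr \<alpha>\<close> with positive coefficients.\<close>

lemma norm_P_term:
  assumes "\<alpha> > 0" "w > -1" "t \<ge> 0"
  shows "norm (P_term \<alpha> w z k t) =
    t powr w * ((norm z * t powr \<alpha>) ^ k / Gamma (\<alpha> * real k + w + 1))"
\<comment> \<open>At \<open>t = 0\<close> both sides vanish, because \<open>0 powr x = 0\<close> for
  every \<open>x\<close>, even for \<open>x = 0\<close>.\<close>
proof (cases "t = 0")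
  case False
  have "\<alpha> * real k \<ge> 0" using assms by simp
  then have "Gamma (\<alpha> * real k + w + 1) > 0" using assms by (intro Gamma_real_pos) linarith
  moreover have "t powr (\<alpha> * real k + w) = t powr w * (t powr \<alpha>) ^ k"
    using assms False by (simp add: powr_add powr_powr[symmetric] powr_realpow)
  ultimately show ?thesis
    by (simp add: P_term_def norm_mult norm_power power_mult_distrib norm_divide)
qed (simp add: P_term_def)

lemma summable_P_term_coeffs:
  assumes "\<alpha> > 0"
  shows "summable (\<lambda>k. x ^ k / Gamma (\<alpha> * real k + w + 1) :: real)"
proof -
  have "summable (\<lambda>k. complex_of_real (x ^ k / Gamma (\<alpha> * real k + w + 1)))"
    using summable_mittag_leffler[OF assms, of "of_real x" "w + 1"] by (simp add: add.assoc)
  then show ?thesis by (simp only: summable_complex_of_real)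
qed

text \<open>The point \<open>t = 0\<close> is included, where all terms and \<open>P_fun\<close>
  vanish by the convention \<open>0 powr x = 0\<close>. The convolution integrand can thus be
  expanded at every point of the closed interval, endpoints included.\<close>

lemma P_term_has_sum:
  assumes "\<alpha> > 0" "w > -1" "t \<ge> 0"
  shows "((\<lambda>k. P_term \<alpha> w z k t) has_sum P_fun \<alpha> w z t) UNIV"
proof (rule norm_summable_imp_has_sum)
  show sm: "summable (\<lambda>k. norm (P_term \<alpha> w z k t))"
    unfolding norm_P_term[OF assms] by (intro summable_mult summable_P_term_coeffs assms)
  have "(\<Sum>k. P_term \<alpha> w z k t) = P_fun \<alpha> w z t"
  proof (cases "t = 0")
    case True
    then show ?thesis by (simp add: P_term_def P_fun_def)
  next
    case False
    then show ?thesis using assms by (simp add: P_fun_series P_term_def)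
  qed
  then show "(\<lambda>k. P_term \<alpha> w z k t) sums P_fun \<alpha> w z t"
    using sm summable_norm_cancel summable_sums by metis
qed

text \<open>Once \<open>x powr w\<close> is factored out, the partial sums increase with
  \<open>x\<close>, so the full series at the right endpoint \<open>t\<close> bounds them uniformly
  in \<open>x\<close> and \<open>N\<close>. The factor \<open>x powr w\<close> has to stay, since
  for negative \<open>w\<close> it is unbounded near 0.\<close>

lemma sum_norm_P_term_bound:
  assumes "\<alpha> > 0" "w > -1"
  shows "\<exists>C\<ge>0. \<forall>N. \<forall>x\<in>{0..t}. (\<Sum>k<N. norm (P_term \<alpha> w z k x)) \<le> C * x powr w"
proof -
  define c where "c x k = (norm z * x powr \<alpha>) ^ k / Gamma (\<alpha> * real k + w + 1)" for x k
  have Gp: "Gamma (\<alpha> * real k + w + 1) > 0" for k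
  proof -
    have "\<alpha> * real k \<ge> 0" using assms by simp
    then show ?thesis using assms by (intro Gamma_real_pos) linarith
  qed
  have c0: "c x k \<ge> 0" for x k using Gp[of k] by (simp add: c_def)
  have sm: "summable (c t)" unfolding c_def by (rule summable_P_term_coeffs[OF assms(1)])
  show ?thesis
  proof (intro exI[of _ "suminf (c t)"] conjI allI ballI)
    show "suminf (c t) \<ge> 0" using c0 sm by (intro suminf_nonneg)
    fix N x assume x: "x \<in> {0..t}"
    have "(\<Sum>k<N. norm (P_term \<alpha> w z k x)) = x powr w * (\<Sum>k<N. c x k)"
      using x norm_P_term[OF assms] by (simp add: c_def sum_distrib_left)
    also have "(\<Sum>k<N. c x k) \<le> (\<Sum>k<N. c t k)"
      unfolding c_def using x assms
      by (intro sum_mono divide_right_mono power_mono mult_left_mono powr_mono2 less_imp_le[OF Gp]) auto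
    also have "\<dots> \<le> suminf (c t)" using sm c0 by (intro sum_le_suminf) auto
    finally show "(\<Sum>k<N. norm (P_term \<alpha> w z k x)) \<le> suminf (c t) * x powr w"
      by (simp add: mult.commute[of "suminf (c t)"] mult_left_mono)
  qed
qed

lemma sum_pairs_le_product:
  fixes f g :: "nat \<Rightarrow> real"
  assumes "finite X" "\<And>k. f k \<ge> 0" "\<And>l. g l \<ge> 0"
    and "\<And>N. (\<Sum>k<N. f k) \<le> A" "\<And>N. (\<Sum>l<N. g l) \<le> B"
  shows "(\<Sum>(k, l)\<in>X. f k * g l) \<le> A * B"
proof -
  \<comment> \<open>Enclose \<open>X\<close> in a square, over which the double sum factors.\<close>
  obtain N where N: "fst ` X \<union> snd ` X \<subseteq> {..<N}"
    using finite_nat_iff_bounded[of "fst ` X \<union> snd ` X"] assms(1) by auto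
  have "(\<Sum>(k, l)\<in>X. f k * g l) \<le> (\<Sum>(k, l)\<in>{..<N} \<times> {..<N}. f k * g l)"
    using N assms by (intro sum_mono2) (force simp: image_subset_iff)+
  also have "\<dots> = (\<Sum>k<N. f k) * (\<Sum>l<N. g l)"
    by (simp add: sum_product sum.cartesian_product)
  also have "\<dots> \<le> A * B"
    \<comment> \<open>That \<open>A\<close> is nonnegative follows from its bound on the empty
      partial sum, \<open>N = 0\<close>.\<close>
    using assms by (intro mult_mono sum_nonneg) (auto intro: order_trans[OF sum_nonneg assms(4)[of 0]])
  finally show ?thesis .
qed

section \<open>The convolution as a double series, and its closed form\<close>

text \<open>In each product of two terms, the Gamma factors in the numerator of the Beta integral
  cancel the denominators of the terms. Apart from the powers of \<open>lam\<close> and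
  \<open>\<sigma>\<close>, the result depends on \<open>k\<close> and \<open>l\<close> only through
  \<open>\<alpha> * real k + \<beta> * real l\<close>, which is what the lattice cancellation
  exploits.\<close>

lemma
  fixes \<alpha> \<beta> w1 w2 t :: real and lam \<sigma> :: complex
  assumes "\<alpha> > 0" "\<beta> > 0" "w1 > -1" "w2 > -1" "t > 0"
  defines "h \<equiv> \<lambda>(k, l). lam ^ k * \<sigma> ^ l *
    of_real (t powr (\<alpha> * real k + \<beta> * real l + w1 + w2 + 1) /
      Gamma (\<alpha> * real k + \<beta> * real l + w1 + w2 + 2))"
  shows causal_conv_exists_P_fun: "causal_conv_exists (P_fun \<alpha> w1 lam) (P_fun \<beta> w2 \<sigma>) t"
    and summable_causal_conv_P_fun: "h summable_on UNIV"
    and causal_conv_P_fun: "causal_conv (P_fun \<alpha> w1 lam) (P_fun \<beta> w2 \<sigma>) t = infsum h UNIV"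
proof -
  \<comment> \<open>The indicator is part of \<open>F\<close>, so that integrals run over all of
    \<open>lborel\<close> and the domination holds at every real \<open>x\<close>.\<close>
  define F where "F = (\<lambda>(k, l) x.
    indicator {0..t} x *\<^sub>R (P_term \<alpha> w1 lam k (t - x) * P_term \<beta> w2 \<sigma> l x))"
  have pos: "\<alpha> * real k \<ge> 0" "\<beta> * real k \<ge> 0" for k using assms by auto
  have Fint: "integrable lborel (F p) \<and> integral\<^sup>L lborel (F p) = h p" for p
  proof (cases p)
    case (Pair k l)
    define a b where "a = \<alpha> * real k + w1" and "b = \<beta> * real l + w2"
    define c where "c = lam ^ k * \<sigma> ^ l / of_real (Gamma (a + 1) * Gamma (b + 1))"
    have ab: "a > -1" "b > -1" using pos[of k] pos[of l] assms unfolding a_def b_def by linarith+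
    have G: "Gamma (a + 1) > 0" "Gamma (b + 1) > 0" using ab by (auto intro!: Gamma_real_pos)
    have F: "F p = (\<lambda>x. c * of_real (indicator {0..t} x *\<^sub>R ((t - x) powr a * x powr b)))"
      unfolding Pair F_def c_def a_def b_def P_term_def by (auto simp: scaleR_conv_of_real)
    note B = Beta_convolution[OF ab assms(5)]
    have FI: "integrable lborel (F p)"
      using B(1) unfolding F set_integrable_def
      by (intro integrable_mult_right integrable_of_real)
    have "integral\<^sup>L lborel (F p) =
        c * of_real (t powr (a + b + 1) * Gamma (a + 1) * Gamma (b + 1) / Gamma (a + b + 2))"
      unfolding F integral_mult_right_zero integral_complex_of_real
      using B(2) unfolding set_lebesgue_integral_def by simp
    also have "\<dots> = lam ^ k * \<sigma> ^ l * of_real (t powr (a + b + 1) / Gamma (a + b + 2))"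
      using G by (simp add: c_def)
    also have "\<dots> = h p" by (simp add: h_def Pair a_def b_def algebra_simps)
    finally show ?thesis using FI by simp
  qed
  obtain A where A: "A \<ge> 0"
      "\<And>N x. x \<in> {0..t} \<Longrightarrow> (\<Sum>k<N. norm (P_term \<alpha> w1 lam k x)) \<le> A * x powr w1"
    using sum_norm_P_term_bound[OF assms(1,3)] by metis
  obtain B where B: "B \<ge> 0"
      "\<And>N x. x \<in> {0..t} \<Longrightarrow> (\<Sum>k<N. norm (P_term \<beta> w2 \<sigma> k x)) \<le> B * x powr w2"
    using sum_norm_P_term_bound[OF assms(2,4)] by metis
  \<comment> \<open>The majorant is the product of the two uniform bounds, at \<open>t - x\<close>
    and at \<open>x\<close>; it is itself a Beta integrand, integrable because \<open>w1\<close> and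
    \<open>w2\<close> exceed -1.\<close>
  define G where "G x = A * B * (indicator {0..t} x *\<^sub>R ((t - x) powr w1 * x powr w2))" for x :: real
  have G: "integrable lborel G"
    using Beta_convolution(1)[OF assms(3-5)] unfolding G_def set_integrable_def by simp
  have bound: "(\<Sum>p\<in>X. norm (F p x)) \<le> G x" if "finite X" for X x
  proof (cases "x \<in> {0..t}")
    case True
    have "(\<Sum>p\<in>X. norm (F p x)) =
        (\<Sum>(k, l)\<in>X. norm (P_term \<alpha> w1 lam k (t - x)) * norm (P_term \<beta> w2 \<sigma> l x))"
      using True by (intro sum.cong) (auto simp: F_def norm_mult)
    also have "\<dots> \<le> (A * (t - x) powr w1) * (B * x powr w2)"
      using True that A B by (intro sum_pairs_le_product) auto
    finally show ?thesis using True by (simp add: G_def mult_ac)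
  next
    case False
    then have "F p x = 0" for p by (cases p) (simp add: F_def)
    then show ?thesis using False by (simp add: G_def)
  qed
  note I = integral_dominated_infsum_pairs[of lborel F G, OF conjunct1[OF Fint] G bound]
  have ptw: "(\<Sum>\<^sub>\<infinity>p. F p x) =
      indicator {0..t} x *\<^sub>R (P_fun \<alpha> w1 lam (t - x) * P_fun \<beta> w2 \<sigma> x)" for x
  proof (cases "x \<in> {0..t}")
    case True
    have "(\<lambda>p. norm (F p x)) summable_on UNIV"
      by (rule nonneg_bdd_above_summable_on) (use bound in \<open>auto intro!: bdd_aboveI2\<close>)
    then have "(\<lambda>p. F p x) summable_on UNIV \<times> UNIV"
      by (simp add: Infinite_Sum.abs_summable_summable)
    then have "(\<Sum>\<^sub>\<infinity>p. F p x) = (\<Sum>\<^sub>\<infinity>k. \<Sum>\<^sub>\<infinity>l. F (k, l) x)"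
      using infsum_Sigma_banach[of "\<lambda>p. F p x" UNIV "\<lambda>_. UNIV"] by simp
    also have "\<dots> = (\<Sum>\<^sub>\<infinity>k. P_term \<alpha> w1 lam k (t - x)) * (\<Sum>\<^sub>\<infinity>l. P_term \<beta> w2 \<sigma> l x)"
      using True by (simp add: F_def infsum_cmult_right' infsum_cmult_left')
    also have "\<dots> = P_fun \<alpha> w1 lam (t - x) * P_fun \<beta> w2 \<sigma> x"
      using True assms by (simp add: infsumI[OF P_term_has_sum])
    finally show ?thesis using True by simp
  next
    case False
    then have "F p x = 0" for p by (cases p) (simp add: F_def)
    then show ?thesis using False by simp
  qed
  show "causal_conv_exists (P_fun \<alpha> w1 lam) (P_fun \<beta> w2 \<sigma>) t"
    using I(1) unfolding ptw causal_conv_exists_def set_integrable_def .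
  show "h summable_on UNIV" using I(2) Fint by simp
  show "causal_conv (P_fun \<alpha> w1 lam) (P_fun \<beta> w2 \<sigma>) t = infsum h UNIV"
    using I(3) Fint unfolding ptw causal_conv_def set_lebesgue_integral_def by simp
qed

lemma causal_conv_P_fun_closed_form:
  fixes \<alpha> \<beta> w1 w2 t :: real and n m :: nat and lam \<sigma> :: complex
  assumes "\<alpha> > 0" "\<beta> > 0" and nm: "\<alpha> * real m = \<beta> * real n"
    and ne: "lam ^ m \<noteq> \<sigma> ^ n"
    and w: "w1 > -1" "w2 > -1" "w = w1 + w2" and "t > 0"
  shows "causal_conv (P_fun \<alpha> w1 lam) (P_fun \<beta> w2 \<sigma>) t =
    (\<Sum>j = 0..<n. \<sigma> ^ j * lam ^ m / (lam ^ m - \<sigma> ^ n) * P_fun \<alpha> (w + 1 + \<beta> * real j) lam t) +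
    (\<Sum>k = 0..<m. lam ^ k * \<sigma> ^ n / (\<sigma> ^ n - lam ^ m) * P_fun \<beta> (w + 1 + \<alpha> * real k) \<sigma> t)"
proof -
  define h where "h = (\<lambda>(k, l). lam ^ k * \<sigma> ^ l *
    of_real (t powr (\<alpha> * real k + \<beta> * real l + w1 + w2 + 1) /
      Gamma (\<alpha> * real k + \<beta> * real l + w1 + w2 + 2)))"
  have pos: "\<alpha> * real k \<ge> 0" "\<beta> * real k \<ge> 0" for k using assms by auto
  have sm: "h summable_on UNIV"
    unfolding h_def using assms by (intro summable_causal_conv_P_fun) auto
  have shift: "lam ^ m * h (k, l + n) = \<sigma> ^ n * h (k + m, l)" for k l
    using nm by (simp add: h_def power_add algebra_simps)
  have row: "(\<Sum>\<^sub>\<infinity>k. h (k, l)) = \<sigma> ^ l * P_fun \<alpha> (w + 1 + \<beta> * real l) lam t" for l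
  proof -
    have "w + 1 + \<beta> * real l > -1" using w pos(2)[of l] by linarith
    then have "P_fun \<alpha> (w + 1 + \<beta> * real l) lam t =
        (\<Sum>\<^sub>\<infinity>k. P_term \<alpha> (w + 1 + \<beta> * real l) lam k t)"
      using assms by (intro infsumI[symmetric] P_term_has_sum) auto
    then show ?thesis
      by (simp add: h_def P_term_def w add_ac mult_ac flip: infsum_cmult_right')
  qed
  have col: "(\<Sum>\<^sub>\<infinity>l. h (k, l)) = lam ^ k * P_fun \<beta> (w + 1 + \<alpha> * real k) \<sigma> t" for k
  proof -
    have "w + 1 + \<alpha> * real k > -1" using w pos(1)[of k] by linarith
    then have "P_fun \<beta> (w + 1 + \<alpha> * real k) \<sigma> t =
        (\<Sum>\<^sub>\<infinity>l. P_term \<beta> (w + 1 + \<alpha> * real k) \<sigma> l t)"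
      using assms by (intro infsumI[symmetric] P_term_has_sum) auto
    then show ?thesis
      by (simp add: h_def P_term_def w add_ac mult_ac flip: infsum_cmult_right')
  qed
  have neg: "\<sigma> ^ n / (\<sigma> ^ n - lam ^ m) = - (\<sigma> ^ n / (lam ^ m - \<sigma> ^ n))"
    by (metis minus_diff_eq minus_divide_right)
  have "(lam ^ m - \<sigma> ^ n) * infsum h UNIV =
      lam ^ m * (\<Sum>j<n. \<sigma> ^ j * P_fun \<alpha> (w + 1 + \<beta> * real j) lam t) -
      \<sigma> ^ n * (\<Sum>k<m. lam ^ k * P_fun \<beta> (w + 1 + \<alpha> * real k) \<sigma> t)"
    using infsum_lattice_strips[OF sm shift] by (simp only: row col)
  then have "infsum h UNIV =
      lam ^ m / (lam ^ m - \<sigma> ^ n) * (\<Sum>j<n. \<sigma> ^ j * P_fun \<alpha> (w + 1 + \<beta> * real j) lam t) -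
      \<sigma> ^ n / (lam ^ m - \<sigma> ^ n) * (\<Sum>k<m. lam ^ k * P_fun \<beta> (w + 1 + \<alpha> * real k) \<sigma> t)"
    using ne by (simp add: eq_divide_eq mult.commute diff_divide_distrib[symmetric])
  also have "\<dots> =
      lam ^ m / (lam ^ m - \<sigma> ^ n) * (\<Sum>j<n. \<sigma> ^ j * P_fun \<alpha> (w + 1 + \<beta> * real j) lam t) +
      \<sigma> ^ n / (\<sigma> ^ n - lam ^ m) * (\<Sum>k<m. lam ^ k * P_fun \<beta> (w + 1 + \<alpha> * real k) \<sigma> t)"
    unfolding neg by simp
  finally have "infsum h UNIV = \<dots>" .
  moreover have "causal_conv (P_fun \<alpha> w1 lam) (P_fun \<beta> w2 \<sigma>) t = infsum h UNIV"
    unfolding h_def using assms by (intro causal_conv_P_fun) auto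
  ultimately show ?thesis
    by (simp add: sum_distrib_left mult_ac flip: lessThan_atLeast0)
qed

lemma R_fun_eq_P_fun: "R_fun \<alpha> v = P_fun \<alpha> (\<alpha> - v - 1)"
  by (simp add: R_fun_def P_fun_def fun_eq_iff)

theorem theorem3p6:
  fixes \<alpha> \<beta> :: real and n m :: nat and lam \<sigma> :: complex
  assumes "\<alpha> > 0" and "\<beta> > 0"
    and "n > 0" and "m > 0" and "coprime n m"
    and "\<alpha> / \<beta> = real n / real m"
    and "lam ^ m \<noteq> \<sigma> ^ n"
  shows
    "(\<forall>w1 w2 w t :: real. w1 > -1 \<and> w2 > -1 \<and> w = w1 + w2 \<and> t > 0 \<longrightarrow>
       causal_conv_exists (P_fun \<alpha> w1 lam) (P_fun \<beta> w2 \<sigma>) t \<and>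
       causal_conv (P_fun \<alpha> w1 lam) (P_fun \<beta> w2 \<sigma>) t =
         (\<Sum>j = 0..<n. \<sigma> ^ j * lam ^ m / (lam ^ m - \<sigma> ^ n) * P_fun \<alpha> (w + 1 + \<beta> * real j) lam t) +
         (\<Sum>k = 0..<m. lam ^ k * \<sigma> ^ n / (\<sigma> ^ n - lam ^ m) * P_fun \<beta> (w + 1 + \<alpha> * real k) \<sigma> t))
     \<and>
     (\<forall>w1 w2 w t :: real. w1 > -1 \<and> w2 > -1 \<and> w = w1 + w2 \<and> t > 0 \<longrightarrow>
       causal_conv_exists
         (\<lambda>t. of_real (t powr w1) * mittag_leffler \<alpha> (w1 + 1) (lam * of_real (t powr \<alpha>)))
         (\<lambda>t. of_real (t powr w2) * mittag_leffler \<beta> (w2 + 1) (\<sigma> * of_real (t powr \<beta>))) t \<and>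
       causal_conv
         (\<lambda>t. of_real (t powr w1) * mittag_leffler \<alpha> (w1 + 1) (lam * of_real (t powr \<alpha>)))
         (\<lambda>t. of_real (t powr w2) * mittag_leffler \<beta> (w2 + 1) (\<sigma> * of_real (t powr \<beta>))) t =
         (\<Sum>j = 0..<n. \<sigma> ^ j * lam ^ m * of_real (t powr (w + 1 + \<beta> * real j)) / (lam ^ m - \<sigma> ^ n) *
            mittag_leffler \<alpha> (w + 2 + \<beta> * real j) (lam * of_real (t powr \<alpha>))) +
         (\<Sum>k = 0..<m. lam ^ k * \<sigma> ^ n * of_real (t powr (w + 1 + \<alpha> * real k)) / (\<sigma> ^ n - lam ^ m) *
            mittag_leffler \<beta> (w + 2 + \<alpha> * real k) (\<sigma> * of_real (t powr \<beta>))))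
     \<and>
     (\<forall>v1 v2 v t :: real. v1 < \<alpha> \<and> v2 < \<beta> \<and> v = v1 + v2 \<and> t > 0 \<longrightarrow>
       causal_conv_exists (R_fun \<alpha> v1 lam) (R_fun \<beta> v2 \<sigma>) t \<and>
       causal_conv (R_fun \<alpha> v1 lam) (R_fun \<beta> v2 \<sigma>) t =
         (\<Sum>j = 0..<n. \<sigma> ^ j * lam ^ m / (lam ^ m - \<sigma> ^ n) * R_fun \<alpha> (v - \<beta> * (real j + 1)) lam t) +
         (\<Sum>k = 0..<m. lam ^ k * \<sigma> ^ n / (\<sigma> ^ n - lam ^ m) * R_fun \<beta> (v - \<alpha> * (real k + 1)) \<sigma> t))"
proof -
  have nm: "\<alpha> * real m = \<beta> * real n" using assms by (simp add: field_simps)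
  have P: "causal_conv_exists (P_fun \<alpha> w1 lam) (P_fun \<beta> w2 \<sigma>) t \<and>
       causal_conv (P_fun \<alpha> w1 lam) (P_fun \<beta> w2 \<sigma>) t =
         (\<Sum>j = 0..<n. \<sigma> ^ j * lam ^ m / (lam ^ m - \<sigma> ^ n) * P_fun \<alpha> (w + 1 + \<beta> * real j) lam t) +
         (\<Sum>k = 0..<m. lam ^ k * \<sigma> ^ n / (\<sigma> ^ n - lam ^ m) * P_fun \<beta> (w + 1 + \<alpha> * real k) \<sigma> t)"
    if "w1 > -1" "w2 > -1" "w = w1 + w2" "t > 0" for w1 w2 w t
    by (intro conjI causal_conv_exists_P_fun causal_conv_P_fun_closed_form nm that assms(1,2,7))
  have R: "causal_conv_exists (R_fun \<alpha> v1 lam) (R_fun \<beta> v2 \<sigma>) t \<and>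
       causal_conv (R_fun \<alpha> v1 lam) (R_fun \<beta> v2 \<sigma>) t =
         (\<Sum>j = 0..<n. \<sigma> ^ j * lam ^ m / (lam ^ m - \<sigma> ^ n) * R_fun \<alpha> (v - \<beta> * (real j + 1)) lam t) +
         (\<Sum>k = 0..<m. lam ^ k * \<sigma> ^ n / (\<sigma> ^ n - lam ^ m) * R_fun \<beta> (v - \<alpha> * (real k + 1)) \<sigma> t)"
    if "v1 < \<alpha>" "v2 < \<beta>" "v = v1 + v2" "t > 0" for v1 v2 v t
    using P[of "\<alpha> - v1 - 1" "\<beta> - v2 - 1" "\<alpha> + \<beta> - v - 2" t] that
    by (simp add: R_fun_eq_P_fun algebra_simps)
  have P_eta: "(\<lambda>t. of_real (t powr w) * mittag_leffler a (w + 1) (z * of_real (t powr a))) = P_fun a w z"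
    for a w z
    by (simp add: P_fun_def fun_eq_iff)
  have P_eq: "c / d * P_fun a (w + 1 + x) z t =
      c * of_real (t powr (w + 1 + x)) / d * mittag_leffler a (w + 2 + x) (z * of_real (t powr a))"
    for c d z and a w x t
    by (simp add: P_fun_def add_ac)
  show ?thesis
    unfolding P_eta P_eq[symmetric]
    by (intro conjI[of "All _"] allI impI; elim conjE) (rule P R; assumption)+
qed

end
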